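(* Let $L$ be a bounded chain, let $n\geqslant 1$, and let $f\colon L^{n}\rightarrow L$ be a function. The following conditions are equivalent: (i) $f$ is a polynomial function. (ii) $f$ is nondecreasing, weakly $\overline{\mathcal{R}}_f$-min homogeneous, and weakly $\overline{\mathcal{R}}_f$-max homogeneous. (iii) $f$ is nondecreasing, weakly $\overline{\mathcal{R}}_f$-min homogeneous, and weakly horizontally $\overline{\mathcal{R}}_f$-maxitive. (iv) $f$ is nondecreasing, weakly horizontally $\overline{\mathcal{R}}_f$-minitive, and weakly $\overline{\mathcal{R}}_f$-max homogeneous. (v) $f$ is nondecreasing, $\overline{\mathcal{R}}_f$-idempotent, weakly horizontally $\overline{\mathcal{R}}_f$-minitive, and weakly horizontally $\overline{\mathcal{R}}_f$-maxitive.
   Context: A bounded chain is a totally ordered set $L$ with least element $0$ and greatest element $1$, viewed as a lattice with $\wedge=\min$, $\vee=\max$. $L^n$ has the componentwise order and operations. A polynomial function $L^n\to L$ is any function obtained by finitely many applications of: (i) for each $i\in\{1,\ldots,n\}$ and $c\in L$, the projection $\mathbf{x}\mapsto x_i$ and the constant function $\mathbf{x}\mapsto c$ are polynomial functions; (ii) if $f,g$ are polynomial functions then so are $f\vee g$ and $f\wedge g$ (pointwise). $f$ is nondecreasing if $\mathbf{a}\leqslant\mathbf{b}$ implies $f(\mathbf{a})\leqslant f(\mathbf{b})$. $\mathcal{R}_f=\{f(\mathbf{x}):\mathbf{x}\in L^n\}$ is the range of $f$, and $\overline{\mathcal{R}}_f$ is its convex hull, i.e. the smallest convex subset of $L$ containing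 $\mathcal{R}_f$ ($S\subseteq L$ is convex if $a,b\in S$, $c\in L$, $a\leqslant c\leqslant b$ imply $c\in S$). For $c\in L$ and $\mathbf{x}\in L^n$: $\mathbf{x}\wedge c=(x_1\wedge c,\ldots,x_n\wedge c)$, $\mathbf{x}\vee c=(x_1\vee c,\ldots,x_n\vee c)$; $[\mathbf{x}]^c$ is the $n$-tuple whose $i$th component is $1$ if $x_i\geqslant c$ and $x_i$ otherwise; $[\mathbf{x}]_c$ is the $n$-tuple whose $i$th component is $0$ if $x_i\leqslant c$ and $x_i$ otherwise. Let $L_n^{(0,2)}=\{\mathbf{x}\in L^n: |\{x_1,\ldots,x_n\}|\leqslant 2\}$. For nonempty $S\subseteq L$, $f$ is: - $S$-idempotent if $f(c,\ldots,c)=c$ for all $c\in S$; - weakly $S$-min homogeneous if $f(\mathbf{x}\wedge c)=f(\mathbf{x})\wedge c$ for all $\mathbf{x}\in L_n^{(0,2)}$, $c\in S$; - weakly $S$-max homogeneous if $f(\mathbf{x}\vee c)=f(\mathbf{x})\vee c$ for all $\mathbf{x}\in L_n^{(0,2)}$, $c\in S$; - weakly horizontally $S$-minitive if $f(\mathbf{x})=f(\mathbf{x}\vee c)\wedge f([\mathbf{x}]^c)$ for all $\mathbf{x}\in L_n^{(0,2)}$, $c\in S$; - weakly horizontally $S$-maxitive if $f(\mathbf{x})=f(\mathbf{x}\wedge c)\vee f([\mathbf{x}]_c)$ for all $\mathbf{x}\in L_n^{(0,2)}$, $c\in S$. *)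

theory Defs
  imports Complex_Main
begin

text \<open>
  A bounded chain is a type of sort \<open>{linorder, order_bot, order_top}\<close>, with
  \<open>bot\<close>, \<open>top\<close>, \<open>min\<close>, \<open>max\<close> in the roles of \<open>0\<close>, \<open>1\<close>, \<open>\<and>\<close>, \<open>\<or>\<close>; the one-element
  chain is included. \<open>L\<^sup>n\<close> is \<open>'n \<Rightarrow> 'a\<close> for a finite index type \<open>'n\<close> with \<open>n = CARD('n) \<ge> 1\<close>.
  The function order of HOL is the componentwise order, so \<open>mono\<close> is ``nondecreasing''.
\<close>

inductive polynomial_function ::
    "(('n::finite \<Rightarrow> 'a::{linorder,order_bot,order_top}) \<Rightarrow> 'a) \<Rightarrow> bool" where
  proj: "polynomial_function (\<lambda>x. x i)"
| const: "polynomial_function (\<lambda>x. c)"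
| join: "polynomial_function f \<Longrightarrow> polynomial_function g \<Longrightarrow>
    polynomial_function (\<lambda>x. max (f x) (g x))"
| meet: "polynomial_function f \<Longrightarrow> polynomial_function g \<Longrightarrow>
    polynomial_function (\<lambda>x. min (f x) (g x))"

definition order_convex :: "'a::order set \<Rightarrow> bool" where
  "order_convex S \<longleftrightarrow> (\<forall>a\<in>S. \<forall>b\<in>S. \<forall>c. a \<le> c \<and> c \<le> b \<longrightarrow> c \<in> S)"

definition range_hull :: "('b \<Rightarrow> 'a::order) \<Rightarrow> 'a set" where
  "range_hull f = order_convex hull (range f)"

text \<open>Intersections of convex sets are convex, so the hull is the smallest convex superset.\<close>

lemma order_convex_Inter: "(\<And>S. S \<in> F \<Longrightarrow> order_convex S) \<Longrightarrow> order_convex (\<Inter>F)"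
  unfolding order_convex_def by blast

lemma order_convex_range_hull: "order_convex (range_hull f)"
  unfolding range_hull_def by (rule hull_in) (rule order_convex_Inter, blast)

definition meet_vec :: "('n \<Rightarrow> 'a::linorder) \<Rightarrow> 'a \<Rightarrow> 'n \<Rightarrow> 'a" where
  "meet_vec x c = (\<lambda>i. min (x i) c)"

definition join_vec :: "('n \<Rightarrow> 'a::linorder) \<Rightarrow> 'a \<Rightarrow> 'n \<Rightarrow> 'a" where
  "join_vec x c = (\<lambda>i. max (x i) c)"

text \<open>\<open>upper_cut x c\<close> is \<open>[x]\<^sup>c\<close> and \<open>lower_cut x c\<close> is \<open>[x]\<^sub>c\<close>.\<close>

definition upper_cut :: "('n \<Rightarrow> 'a::{linorder,order_top}) \<Rightarrow> 'a \<Rightarrow> 'n \<Rightarrow> 'a" where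
  "upper_cut x c = (\<lambda>i. if x i \<ge> c then top else x i)"

definition lower_cut :: "('n \<Rightarrow> 'a::{linorder,order_bot}) \<Rightarrow> 'a \<Rightarrow> 'n \<Rightarrow> 'a" where
  "lower_cut x c = (\<lambda>i. if x i \<le> c then bot else x i)"

text \<open>The set \<open>L\<^sub>n\<close> with superscript \<open>(0,2)\<close>; finiteness of \<open>'n\<close> makes \<open>card\<close> meaningful here.\<close>

definition two_valued :: "('n::finite \<Rightarrow> 'a) set" where
  "two_valued = {x. card (range x) \<le> 2}"

definition idempotent_on :: "'a set \<Rightarrow> (('n \<Rightarrow> 'a) \<Rightarrow> 'a) \<Rightarrow> bool" where
  "idempotent_on S f \<longleftrightarrow> (\<forall>c\<in>S. f (\<lambda>i. c) = c)"

definition weakly_min_homogeneous ::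
    "'a::linorder set \<Rightarrow> (('n::finite \<Rightarrow> 'a) \<Rightarrow> 'a) \<Rightarrow> bool" where
  "weakly_min_homogeneous S f \<longleftrightarrow>
     (\<forall>x\<in>two_valued. \<forall>c\<in>S. f (meet_vec x c) = min (f x) c)"

definition weakly_max_homogeneous ::
    "'a::linorder set \<Rightarrow> (('n::finite \<Rightarrow> 'a) \<Rightarrow> 'a) \<Rightarrow> bool" where
  "weakly_max_homogeneous S f \<longleftrightarrow>
     (\<forall>x\<in>two_valued. \<forall>c\<in>S. f (join_vec x c) = max (f x) c)"

definition weakly_horizontally_minitive ::
    "'a::{linorder,order_top} set \<Rightarrow> (('n::finite \<Rightarrow> 'a) \<Rightarrow> 'a) \<Rightarrow> bool" where
  "weakly_horizontally_minitive S f \<longleftrightarrow>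
     (\<forall>x\<in>two_valued. \<forall>c\<in>S. f x = min (f (join_vec x c)) (f (upper_cut x c)))"

definition weakly_horizontally_maxitive ::
    "'a::{linorder,order_bot} set \<Rightarrow> (('n::finite \<Rightarrow> 'a) \<Rightarrow> 'a) \<Rightarrow> bool" where
  "weakly_horizontally_maxitive S f \<longleftrightarrow>
     (\<forall>x\<in>two_valued. \<forall>c\<in>S. f x = max (f (meet_vec x c)) (f (lower_cut x c)))"

end

theory Submission
  imports Defs
begin

text \<open>
  Write \<open>B\<close> and \<open>T\<close> for the values of a nondecreasing \<open>f\<close> at the bottom and the top vector; the
  convex hull of the range of \<open>f\<close> is the interval \<open>[B, T]\<close>. For a set \<open>I\<close> of indices let
  \<open>1\<^sub>I\<close> be its characteristic vector.

  The pivot between all the conditions is a pair of inequalities in a threshold \<open>c\<close>: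
  \<open>f x \<and> c \<le> f (x \<and> c)\<close> and \<open>f (x \<or> c) \<le> f x \<or> c\<close>. A polynomial function satisfies them for
  every \<open>x\<close> and every \<open>c\<close>, because projections and constants do and both inequalities pass to
  joins and meets. Together with monotonicity they give idempotency on \<open>[B, T]\<close>, both
  homogeneities and both horizontal decompositions, even at all vectors \<open>x\<close>.

  Conversely, a nondecreasing \<open>f\<close> which satisfies the two inequalities merely at the vectors
  \<open>1\<^sub>I\<close> is already polynomial, as it coincides with its disjunctive normal form
  \<open>\<Or>\<^sub>I (f 1\<^sub>I \<and> \<And>\<^sub>i\<^sub>\<in>\<^sub>I x\<^sub>i)\<close>: the inequality for meets puts each term below \<open>f x\<close>, and the
  inequality for joins shows that the term of \<open>I = {i. f x \<le> x\<^sub>i}\<close> reaches \<open>f x\<close>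
  (\<open>polynomial_functionI\<close>).

  It remains to extract the two inequalities from the weak conditions. The vectors
  \<open>1\<^sub>I \<and> c\<close> and \<open>1\<^sub>I \<or> c\<close> take at most two values, which is why conditions on two-valued vectors
  suffice. The conditions speak only about \<open>c \<in> [B, T]\<close>; for other thresholds the inequalities
  are trivial or follow from the case \<open>c = B\<close> or \<open>c = T\<close>, because \<open>f\<close> takes its values in
  \<open>[B, T]\<close>. A homogeneity yields its inequality at once. A horizontal decomposition at \<open>c\<close> yields it as soon
  as \<open>f\<close> is idempotent at \<open>c\<close>, and each homogeneity implies this idempotency.
\<close>

section \<open>The range hull of a nondecreasing function\<close>

lemma mono_range_hull_eq:
  fixes f :: "('n \<Rightarrow> 'a::{linorder,order_bot,order_top}) \<Rightarrow> 'a"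
  assumes "mono f"
  shows "range_hull f = {f (\<lambda>_. bot)..f (\<lambda>_. top)}"
proof
  have range: "f (\<lambda>_. bot) \<le> f x \<and> f x \<le> f (\<lambda>_. top)" for x
    by (auto intro!: monoD[OF assms] simp: le_fun_def)
  show "range_hull f \<subseteq> {f (\<lambda>_. bot)..f (\<lambda>_. top)}"
    unfolding range_hull_def
    by (rule hull_minimal) (use range in \<open>auto simp: order_convex_def intro: order_trans\<close>)
  have sub: "range f \<subseteq> range_hull f"
    unfolding range_hull_def by (rule hull_subset)
  show "{f (\<lambda>_. bot)..f (\<lambda>_. top)} \<subseteq> range_hull f"
  proof
    fix c assume "c \<in> {f (\<lambda>_. bot)..f (\<lambda>_. top)}"
    moreover have "f (\<lambda>_. bot) \<in> range_hull f" "f (\<lambda>_. top) \<in> range_hull f"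
      using sub by blast+
    ultimately show "c \<in> range_hull f"
      using order_convex_range_hull[of f] unfolding order_convex_def by (meson atLeastAtMost_iff)
  qed
qed

section \<open>Threshold inequalities for polynomial functions\<close>

lemma polynomial_function_mono:
  fixes f :: "('n::finite \<Rightarrow> 'a::{linorder,order_bot,order_top}) \<Rightarrow> 'a"
  assumes "polynomial_function f"
  shows "mono f"
  using assms
proof induction
  case (proj i)
  show ?case by (rule monoI) (simp add: le_fun_def)
next
  case (const c)
  show ?case by (rule monoI) simp
next
  case (join f g)
  then show ?case by (intro monoI max.mono) (auto dest: monoD)
next
  case (meet f g)
  then show ?case by (intro monoI min.mono) (auto dest: monoD)
qed

lemma polynomial_function_meet_vec:
  fixes f :: "('n::finite \<Rightarrow> 'a::{linorder,order_bot,order_top}) \<Rightarrow> 'a"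
  assumes "polynomial_function f"
  shows "min (f x) c \<le> f (meet_vec x c)"
  using assms
proof induction
  case (proj i)
  show ?case by (simp add: meet_vec_def)
next
  case (const k)
  show ?case by simp
next
  case (join f g)
  then show ?case by (auto simp: min_le_iff_disj le_max_iff_disj)
next
  case (meet f g)
  then show ?case by (auto simp: min_le_iff_disj le_max_iff_disj)
qed

lemma polynomial_function_join_vec:
  fixes f :: "('n::finite \<Rightarrow> 'a::{linorder,order_bot,order_top}) \<Rightarrow> 'a"
  assumes "polynomial_function f"
  shows "f (join_vec x c) \<le> max (f x) c"
  using assms
proof induction
  case (proj i)
  show ?case by (simp add: join_vec_def)
next
  case (const k)
  show ?case by simp
next
  case (join f g)
  then show ?case by (auto simp: min_le_iff_disj le_max_iff_disj)
next
  case (meet f g)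
  then show ?case by (auto simp: min_le_iff_disj le_max_iff_disj)
qed

text \<open>
  A constant vector is the top vector met with \<open>c\<close> and also the bottom vector joined with \<open>c\<close>, so
  the two threshold inequalities enclose its value between \<open>T \<and> c\<close> and \<open>B \<or> c\<close>.
\<close>

lemma polynomial_function_idempotent_on:
  fixes f :: "('n::finite \<Rightarrow> 'a::{linorder,order_bot,order_top}) \<Rightarrow> 'a"
  assumes f: "polynomial_function f"
  shows "idempotent_on (range_hull f) f"
  unfolding idempotent_on_def
    mono_range_hull_eq[OF polynomial_function_mono[OF f]]
proof
  fix c assume "c \<in> {f (\<lambda>_. bot)..f (\<lambda>_. top)}"
  then show "f (\<lambda>i. c) = c"
    using polynomial_function_meet_vec[OF f, of "\<lambda>_. top" c]
      polynomial_function_join_vec[OF f, of "\<lambda>_. bot" c]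
    by (simp add: meet_vec_def join_vec_def min_absorb2 max_absorb2)
qed

lemma polynomial_function_min_homogeneous:
  fixes f :: "('n::finite \<Rightarrow> 'a::{linorder,order_bot,order_top}) \<Rightarrow> 'a"
  assumes f: "polynomial_function f" and c: "c \<in> range_hull f"
  shows "f (meet_vec x c) = min (f x) c"
proof (rule antisym)
  have "f (meet_vec x c) \<le> f x" "f (meet_vec x c) \<le> f (\<lambda>_. c)"
    by (auto intro!: monoD[OF polynomial_function_mono[OF f]] simp: le_fun_def meet_vec_def)
  then show "f (meet_vec x c) \<le> min (f x) c"
    using polynomial_function_idempotent_on[OF f] c by (simp add: idempotent_on_def)
qed (rule polynomial_function_meet_vec[OF f])

lemma polynomial_function_max_homogeneous:
  fixes f :: "('n::finite \<Rightarrow> 'a::{linorder,order_bot,order_top}) \<Rightarrow> 'a"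
  assumes f: "polynomial_function f" and c: "c \<in> range_hull f"
  shows "f (join_vec x c) = max (f x) c"
proof (rule antisym)
  have "f x \<le> f (join_vec x c)" "f (\<lambda>_. c) \<le> f (join_vec x c)"
    by (auto intro!: monoD[OF polynomial_function_mono[OF f]] simp: le_fun_def join_vec_def)
  then show "max (f x) c \<le> f (join_vec x c)"
    using polynomial_function_idempotent_on[OF f] c by (simp add: idempotent_on_def)
qed (rule polynomial_function_join_vec[OF f])

text \<open>
  If \<open>f x \<le> c\<close>, the part \<open>x \<and> c\<close> alone has value at least \<open>f x\<close>. Otherwise \<open>x \<le> [x]\<^sub>c \<or> c\<close>, and
  the threshold \<open>c < f x\<close> cannot account for the value \<open>f x\<close>, so \<open>[x]\<^sub>c\<close> does.
\<close>

lemma polynomial_function_horizontally_maxitive: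
  fixes f :: "('n::finite \<Rightarrow> 'a::{linorder,order_bot,order_top}) \<Rightarrow> 'a"
  assumes f: "polynomial_function f"
  shows "f x = max (f (meet_vec x c)) (f (lower_cut x c))"
proof (rule antisym)
  note mono = polynomial_function_mono[OF f]
  have "f x \<le> f (join_vec (lower_cut x c) c)"
    by (rule monoD[OF mono]) (auto simp: le_fun_def join_vec_def lower_cut_def)
  also have "\<dots> \<le> max (f (lower_cut x c)) c"
    by (rule polynomial_function_join_vec[OF f])
  finally show "f x \<le> max (f (meet_vec x c)) (f (lower_cut x c))"
    using polynomial_function_meet_vec[OF f, of x c]
    by (cases "f x \<le> c") (simp_all add: le_max_iff_disj min_absorb1)
  have "f (meet_vec x c) \<le> f x" "f (lower_cut x c) \<le> f x"
    by (auto intro!: monoD[OF mono] simp: le_fun_def meet_vec_def lower_cut_def)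
  then show "max (f (meet_vec x c)) (f (lower_cut x c)) \<le> f x" by simp
qed

lemma polynomial_function_horizontally_minitive:
  fixes f :: "('n::finite \<Rightarrow> 'a::{linorder,order_bot,order_top}) \<Rightarrow> 'a"
  assumes f: "polynomial_function f"
  shows "f x = min (f (join_vec x c)) (f (upper_cut x c))"
proof (rule antisym)
  note mono = polynomial_function_mono[OF f]
  have "min (f (upper_cut x c)) c \<le> f (meet_vec (upper_cut x c) c)"
    by (rule polynomial_function_meet_vec[OF f])
  also have "\<dots> \<le> f x"
    by (rule monoD[OF mono]) (auto simp: le_fun_def meet_vec_def upper_cut_def)
  finally show "min (f (join_vec x c)) (f (upper_cut x c)) \<le> f x"
    using polynomial_function_join_vec[OF f, of x c]
    by (cases "c \<le> f x") (simp_all add: min_le_iff_disj max_absorb1)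
  have "f x \<le> f (join_vec x c)" "f x \<le> f (upper_cut x c)"
    by (auto intro!: monoD[OF mono] simp: le_fun_def join_vec_def upper_cut_def)
  then show "f x \<le> min (f (join_vec x c)) (f (upper_cut x c))" by simp
qed

section \<open>Disjunctive normal forms\<close>

lemma polynomial_function_Min:
  fixes c :: "'a::{linorder,order_bot,order_top}" and I :: "'n::finite set"
  shows "polynomial_function (\<lambda>x. Min (insert c (x ` I)))"
proof (induction I rule: finite_induct[OF finite])
  case 1
  show ?case by (simp add: polynomial_function.const)
next
  case (2 i I)
  have "Min (insert c (x ` insert i I)) = min (x i) (Min (insert c (x ` I)))" for x :: "'n \<Rightarrow> 'a"
    by (simp add: insert_commute[of c] del: Min_insert) (simp add: Min_insert)
  then show ?case
    using polynomial_function.meet[OF polynomial_function.proj 2(3)] by simp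
qed

lemma polynomial_function_Max:
  fixes g :: "'b \<Rightarrow> ('n::finite \<Rightarrow> 'a::{linorder,order_bot,order_top}) \<Rightarrow> 'a"
  assumes "finite A" "A \<noteq> {}" "\<And>a. polynomial_function (g a)"
  shows "polynomial_function (\<lambda>x. Max ((\<lambda>a. g a x) ` A))"
  using assms(1,2)
proof (induction A rule: finite_ne_induct)
  case (singleton a)
  show ?case by (simp add: assms(3))
next
  case (insert a A)
  then show ?case
    using polynomial_function.join[OF assms(3) insert.IH] by simp
qed

text \<open>
  The vector \<open>1\<^sub>I\<close> is \<open>two_step top bot I\<close>, while
  \<open>1\<^sub>I \<and> c\<close> and \<open>1\<^sub>I \<or> c\<close> are \<open>two_step c bot I\<close> and \<open>two_step top c I\<close>.
\<close>

definition two_step :: "'a \<Rightarrow> 'a \<Rightarrow> 'n set \<Rightarrow> 'n \<Rightarrow> 'a" where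
  "two_step a b I = (\<lambda>i. if i \<in> I then a else b)"

lemma two_step_two_valued: "(two_step a b I :: 'n::finite \<Rightarrow> 'a) \<in> two_valued"
proof -
  have "card (range (two_step a b I :: 'n \<Rightarrow> 'a)) \<le> card {a, b}"
    by (rule card_mono) (auto simp: two_step_def)
  also have "\<dots> \<le> 2" by (simp add: card_insert_if)
  finally show ?thesis by (simp add: two_valued_def)
qed

lemma const_two_valued: "(\<lambda>_::'n::finite. c) \<in> two_valued"
  using two_step_two_valued[of c c "UNIV :: 'n set"] by (simp add: two_step_def)

lemma meet_vec_two_step:
  fixes c :: "'a::{linorder,order_bot,order_top}"
  shows "meet_vec (two_step top bot I) c = two_step c bot I"
  by (auto simp: meet_vec_def two_step_def min_absorb1 min_absorb2)

lemma join_vec_two_step: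
  fixes c :: "'a::{linorder,order_bot,order_top}"
  shows "join_vec (two_step top bot I) c = two_step top c I"
  by (auto simp: join_vec_def two_step_def max_absorb1 max_absorb2)

text \<open>
  The function equals its disjunctive normal form. A term \<open>f 1\<^sub>I \<and> c\<close> with \<open>c\<close> the least
  coordinate of \<open>x\<close> on \<open>I\<close> is at most \<open>f (1\<^sub>I \<and> c)\<close>, and \<open>1\<^sub>I \<and> c \<le> x\<close>. For the reverse
  inequality let \<open>t = f x\<close> and \<open>I = {i. t \<le> x\<^sub>i}\<close>. If \<open>s\<close> is the largest coordinate outside
  \<open>I\<close>, then \<open>s < t\<close> and \<open>x \<le> 1\<^sub>I \<or> s\<close>, whence \<open>t \<le> f 1\<^sub>I \<or> s\<close> and so \<open>t \<le> f 1\<^sub>I\<close>; if no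
  index lies outside \<open>I\<close>, this holds by monotonicity. Hence the term of \<open>I\<close> is at least \<open>t\<close>.
\<close>

lemma polynomial_functionI:
  fixes f :: "('n::finite \<Rightarrow> 'a::{linorder,order_bot,order_top}) \<Rightarrow> 'a"
  assumes mono: "mono f"
    and meet: "\<And>I c. min (f (two_step top bot I)) c \<le> f (two_step c bot I)"
    and join: "\<And>I c. f (two_step top c I) \<le> max (f (two_step top bot I)) c"
  shows "polynomial_function f"
proof -
  define g where "g I x = Min (insert (f (two_step top bot I)) (x ` I))" for I and x :: "'n \<Rightarrow> 'a"
  have "f x = Max ((\<lambda>I. g I x) ` UNIV)" for x
  proof (rule antisym)
    define I where "I = {i. f x \<le> x i}"
    have "f x \<le> f (two_step top bot I)"
    proof (cases "I = UNIV")
      case True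
      then show ?thesis
        by (auto intro!: monoD[OF mono] simp: le_fun_def two_step_def)
    next
      case False
      define s where "s = Max (x ` (- I))"
      have "s \<in> x ` (- I)"
        unfolding s_def using False by (intro Max_in) auto
      then have "s < f x" by (auto simp: I_def not_le)
      have "x i \<le> s" if "i \<notin> I" for i
        unfolding s_def using that by (intro Max_ge) auto
      then have "f x \<le> f (two_step top s I)"
        by (auto intro!: monoD[OF mono] simp: le_fun_def two_step_def)
      also have "\<dots> \<le> max (f (two_step top bot I)) s" by (rule join)
      finally show ?thesis using \<open>s < f x\<close> by (auto simp: le_max_iff_disj)
    qed
    then have "f x \<le> g I x" by (auto simp: g_def I_def)
    also have "\<dots> \<le> Max ((\<lambda>I. g I x) ` UNIV)" by (rule Max_ge) auto
    finally show "f x \<le> Max ((\<lambda>I. g I x) ` UNIV)" .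
  next
    have "g I x \<le> f x" for I
    proof -
      \<comment> \<open>Including \<open>top\<close> gives the empty set of indices a least coordinate as well.\<close>
      define c where "c = Min (insert top (x ` I))"
      have c: "c \<le> x i" if "i \<in> I" for i
        unfolding c_def using that by (intro Min_le) auto
      have "c \<in> insert top (x ` I)"
        unfolding c_def by (intro Min_in) auto
      then have "g I x \<le> min (f (two_step top bot I)) c"
        by (auto simp: g_def intro: Min_le)
      also have "\<dots> \<le> f (two_step c bot I)" by (rule meet)
      also have "\<dots> \<le> f x"
        using c by (auto intro!: monoD[OF mono] simp: le_fun_def two_step_def)
      finally show ?thesis .
    qed
    then show "Max ((\<lambda>I. g I x) ` UNIV) \<le> f x" by simp
  qed
  then have eq: "f = (\<lambda>x. Max ((\<lambda>I. g I x) ` UNIV))" by blast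
  show ?thesis
    by (subst eq, rule polynomial_function_Max) (simp_all add: g_def polynomial_function_Min)
qed

text \<open>
  Only thresholds in \<open>[B, T]\<close> matter. For the meet inequality, \<open>c < B\<close> makes the left side smaller
  than every value of \<open>f\<close>, and \<open>c > T\<close> gives the same left side as \<open>T\<close> and a right side no
  smaller; the join inequality is dual.
\<close>

lemma polynomial_functionI_range_hull:
  fixes f :: "('n::finite \<Rightarrow> 'a::{linorder,order_bot,order_top}) \<Rightarrow> 'a"
  assumes mono: "mono f"
    and meet: "\<And>I c. c \<in> range_hull f \<Longrightarrow> min (f (two_step top bot I)) c \<le> f (two_step c bot I)"
    and join: "\<And>I c. c \<in> range_hull f \<Longrightarrow> f (two_step top c I) \<le> max (f (two_step top bot I)) c"
  shows "polynomial_function f"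
proof (rule polynomial_functionI[OF mono])
  note hull = mono_range_hull_eq[OF mono]
  have bounds: "f (\<lambda>_. bot) \<le> f x" "f x \<le> f (\<lambda>_. top)" for x
    by (auto intro!: monoD[OF mono] simp: le_fun_def)
  fix I c
  consider "c < f (\<lambda>_. bot)" | "c \<in> range_hull f" | "f (\<lambda>_. top) < c"
    by (auto simp: hull not_le[symmetric])
  note range_cases = this
  show "min (f (two_step top bot I)) c \<le> f (two_step c bot I)"
  proof (cases rule: range_cases)
    case 1
    then show ?thesis
      using bounds(1)[of "two_step c bot I"] by (auto simp: min_le_iff_disj)
  next
    case 2
    then show ?thesis by (rule meet)
  next
    case 3
    have "min (f (two_step top bot I)) c \<le> min (f (two_step top bot I)) (f (\<lambda>_. top))"
      using bounds by (simp add: min_le_iff_disj)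
    also have "\<dots> \<le> f (two_step (f (\<lambda>_. top)) bot I)"
      by (rule meet) (simp add: hull bounds)
    also have "\<dots> \<le> f (two_step c bot I)"
      using 3 by (auto intro!: monoD[OF mono] simp: le_fun_def two_step_def)
    finally show ?thesis .
  qed
  show "f (two_step top c I) \<le> max (f (two_step top bot I)) c"
  proof (cases rule: range_cases)
    case 1
    have "f (two_step top c I) \<le> f (two_step top (f (\<lambda>_. bot)) I)"
      using 1 by (auto intro!: monoD[OF mono] simp: le_fun_def two_step_def)
    also have "\<dots> \<le> max (f (two_step top bot I)) (f (\<lambda>_. bot))"
      by (rule join) (simp add: hull bounds)
    also have "\<dots> \<le> max (f (two_step top bot I)) c"
      using bounds by (simp add: le_max_iff_disj)
    finally show ?thesis .
  next
    case 2
    then show ?thesis by (rule join)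
  next
    case 3
    then show ?thesis
      using bounds(2)[of "two_step top c I"] by (auto simp: le_max_iff_disj)
  qed
qed

section \<open>Consequences of the weak conditions\<close>

lemma weakly_min_homogeneous_meet:
  fixes f :: "('n::finite \<Rightarrow> 'a::{linorder,order_bot,order_top}) \<Rightarrow> 'a"
  assumes "weakly_min_homogeneous S f" "c \<in> S"
  shows "min (f (two_step top bot I)) c \<le> f (two_step c bot I)"
proof -
  have "f (meet_vec (two_step top bot I) c) = min (f (two_step top bot I)) c"
    using assms by (simp add: weakly_min_homogeneous_def two_step_two_valued)
  then show ?thesis by (simp add: meet_vec_two_step)
qed

lemma weakly_max_homogeneous_join:
  fixes f :: "('n::finite \<Rightarrow> 'a::{linorder,order_bot,order_top}) \<Rightarrow> 'a"
  assumes "weakly_max_homogeneous S f" "c \<in> S"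
  shows "f (two_step top c I) \<le> max (f (two_step top bot I)) c"
proof -
  have "f (join_vec (two_step top bot I) c) = max (f (two_step top bot I)) c"
    using assms by (simp add: weakly_max_homogeneous_def two_step_two_valued)
  then show ?thesis by (simp add: join_vec_two_step)
qed

lemma weakly_min_homogeneous_idempotent_on:
  fixes f :: "('n::finite \<Rightarrow> 'a::{linorder,order_bot,order_top}) \<Rightarrow> 'a"
  assumes "mono f" "weakly_min_homogeneous (range_hull f) f"
  shows "idempotent_on (range_hull f) f"
  unfolding idempotent_on_def
proof
  fix c assume c: "c \<in> range_hull f"
  have "f (meet_vec (\<lambda>_. top) c) = min (f (\<lambda>_. top)) c"
    using assms(2) c by (simp add: weakly_min_homogeneous_def const_two_valued)
  then show "f (\<lambda>i. c) = c"
    using c by (simp add: mono_range_hull_eq[OF assms(1)] meet_vec_def min_absorb2)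
qed

lemma weakly_max_homogeneous_idempotent_on:
  fixes f :: "('n::finite \<Rightarrow> 'a::{linorder,order_bot,order_top}) \<Rightarrow> 'a"
  assumes "mono f" "weakly_max_homogeneous (range_hull f) f"
  shows "idempotent_on (range_hull f) f"
  unfolding idempotent_on_def
proof
  fix c assume c: "c \<in> range_hull f"
  have "f (join_vec (\<lambda>_. bot) c) = max (f (\<lambda>_. bot)) c"
    using assms(2) c by (simp add: weakly_max_homogeneous_def const_two_valued)
  then show "f (\<lambda>i. c) = c"
    using c by (simp add: mono_range_hull_eq[OF assms(1)] join_vec_def max_absorb2)
qed

text \<open>
  Decompose \<open>x = 1\<^sub>I \<or> c\<close> at the threshold \<open>c\<close> itself: \<open>x \<and> c\<close> is constant, with value \<open>c\<close> by
  idempotency, and \<open>[x]\<^sub>c\<close> is \<open>1\<^sub>I\<close> unless \<open>c = 1\<close>, when all of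
  \<open>x\<close> is cut off; in both cases it lies below \<open>1\<^sub>I\<close>.
\<close>

lemma weakly_horizontally_maxitive_join:
  fixes f :: "('n::finite \<Rightarrow> 'a::{linorder,order_bot,order_top}) \<Rightarrow> 'a"
  assumes "mono f" "idempotent_on S f" "weakly_horizontally_maxitive S f" "c \<in> S"
  shows "f (two_step top c I) \<le> max (f (two_step top bot I)) c"
proof -
  let ?x = "two_step top c I"
  have "f ?x = max (f (meet_vec ?x c)) (f (lower_cut ?x c))"
    using assms(3,4) unfolding weakly_horizontally_maxitive_def by (blast intro: two_step_two_valued)
  moreover have "meet_vec ?x c = (\<lambda>_. c)"
    by (auto simp: meet_vec_def two_step_def min_absorb2)
  moreover have "f (\<lambda>_. c) = c"
    using assms(2,4) by (simp add: idempotent_on_def)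
  moreover have "f (lower_cut ?x c) \<le> f (two_step top bot I)"
    by (auto intro!: monoD[OF assms(1)] simp: le_fun_def lower_cut_def two_step_def)
  ultimately show ?thesis by (simp add: max.commute[of _ c] max.coboundedI2)
qed

lemma weakly_horizontally_minitive_meet:
  fixes f :: "('n::finite \<Rightarrow> 'a::{linorder,order_bot,order_top}) \<Rightarrow> 'a"
  assumes "mono f" "idempotent_on S f" "weakly_horizontally_minitive S f" "c \<in> S"
  shows "min (f (two_step top bot I)) c \<le> f (two_step c bot I)"
proof -
  let ?x = "two_step c bot I"
  have "f ?x = min (f (join_vec ?x c)) (f (upper_cut ?x c))"
    using assms(3,4) unfolding weakly_horizontally_minitive_def by (blast intro: two_step_two_valued)
  moreover have "join_vec ?x c = (\<lambda>_. c)"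
    by (auto simp: join_vec_def two_step_def max_absorb2)
  moreover have "f (\<lambda>_. c) = c"
    using assms(2,4) by (simp add: idempotent_on_def)
  moreover have "f (two_step top bot I) \<le> f (upper_cut ?x c)"
    by (auto intro!: monoD[OF assms(1)] simp: le_fun_def upper_cut_def two_step_def)
  ultimately show ?thesis by (simp add: min.commute[of _ c] min.coboundedI2)
qed

section \<open>Characterizations of polynomial functions\<close>

theorem theorem14:
  fixes f :: "('n::finite \<Rightarrow> 'a::{linorder,order_bot,order_top}) \<Rightarrow> 'a"
  shows "(polynomial_function f \<longleftrightarrow>
           mono f \<and> weakly_min_homogeneous (range_hull f) f \<and>
           weakly_max_homogeneous (range_hull f) f) \<and>
         (polynomial_function f \<longleftrightarrow>
           mono f \<and> weakly_min_homogeneous (range_hull f) f \<and>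
           weakly_horizontally_maxitive (range_hull f) f) \<and>
         (polynomial_function f \<longleftrightarrow>
           mono f \<and> weakly_horizontally_minitive (range_hull f) f \<and>
           weakly_max_homogeneous (range_hull f) f) \<and>
         (polynomial_function f \<longleftrightarrow>
           mono f \<and> idempotent_on (range_hull f) f \<and>
           weakly_horizontally_minitive (range_hull f) f \<and>
           weakly_horizontally_maxitive (range_hull f) f)"
proof -
  let ?S = "range_hull f"
  have min_hom: "weakly_min_homogeneous ?S f" if "polynomial_function f"
    using polynomial_function_min_homogeneous[OF that]
    by (simp add: weakly_min_homogeneous_def)
  have max_hom: "weakly_max_homogeneous ?S f" if "polynomial_function f"
    using polynomial_function_max_homogeneous[OF that]
    by (simp add: weakly_max_homogeneous_def)
  have maxitive: "weakly_horizontally_maxitive ?S f" if "polynomial_function f"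
    unfolding weakly_horizontally_maxitive_def
    using polynomial_function_horizontally_maxitive[OF that] by blast
  have minitive: "weakly_horizontally_minitive ?S f" if "polynomial_function f"
    unfolding weakly_horizontally_minitive_def
    using polynomial_function_horizontally_minitive[OF that] by blast
  note necessary = polynomial_function_mono polynomial_function_idempotent_on
    min_hom max_hom maxitive minitive
  have ii: "polynomial_function f"
    if "mono f" "weakly_min_homogeneous ?S f" "weakly_max_homogeneous ?S f"
    by (rule polynomial_functionI_range_hull[OF that(1)
          weakly_min_homogeneous_meet[OF that(2)] weakly_max_homogeneous_join[OF that(3)]])
  have iii: "polynomial_function f"
    if "mono f" "weakly_min_homogeneous ?S f" "weakly_horizontally_maxitive ?S f"
    by (rule polynomial_functionI_range_hull[OF that(1) weakly_min_homogeneous_meet[OF that(2)]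
          weakly_horizontally_maxitive_join[OF that(1)
            weakly_min_homogeneous_idempotent_on[OF that(1,2)] that(3)]])
  have iv: "polynomial_function f"
    if "mono f" "weakly_horizontally_minitive ?S f" "weakly_max_homogeneous ?S f"
    by (rule polynomial_functionI_range_hull[OF that(1)
          weakly_horizontally_minitive_meet[OF that(1)
            weakly_max_homogeneous_idempotent_on[OF that(1,3)] that(2)]
          weakly_max_homogeneous_join[OF that(3)]])
  have v: "polynomial_function f"
    if "mono f" "idempotent_on ?S f"
      "weakly_horizontally_minitive ?S f" "weakly_horizontally_maxitive ?S f"
    by (rule polynomial_functionI_range_hull[OF that(1)
          weakly_horizontally_minitive_meet[OF that(1,2,3)]
          weakly_horizontally_maxitive_join[OF that(1,2,4)]])
  show ?thesis
    using necessary ii iii iv v by blast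
qed

end
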